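(* Let $(\mathcal{S},\mathcal{A},\mathcal{P},\boldsymbol{r},\gamma)$ be a finite multi-objective MDP with $d$ objectives, let $\alpha>0$, and let $\Lambda\subset\mathbb{R}^d$ be the unit simplex. Let $\{\pi_k\}_{k\ge 0}$ be a sequence of preference-dependent policies generated by $\boldsymbol{Q}$-Pensieve soft policy iteration: $\pi_0$ is an arbitrary preference-dependent policy and, for every $k\ge 0$, every $\boldsymbol{\lambda}\in\Lambda$ and every $s\in\mathcal{S}$, $$\pi_{k+1}(\cdot\mid s;\boldsymbol{\lambda})=\arg\min_{\pi'\in\Pi}\ \mathrm{D}_{\mathrm{KL}}\left(\pi'(\cdot\mid s;\boldsymbol{\lambda})\ \Big\|\ \frac{\exp\big(\sup_{\boldsymbol{\lambda}'\in W_k(\boldsymbol{\lambda}),\,\boldsymbol{Q}'\in\mathcal{Q}_k}\frac{1}{\alpha}\boldsymbol{\lambda}^\top\boldsymbol{Q}'(s,\cdot;\boldsymbol{\lambda}')\big)}{Z_{\mathcal{Q}_k}(s)}\right),$$ where $Z_{\mathcal{Q}_k}(s)$ is the normalizing constant, $W_k(\boldsymbol{\lambda})\subset\Lambda$ is any set of preferences with $\boldsymbol{\lambda}\in W_k(\boldsymbol{\lambda})$, and $\mathcal{Q}_k$ is any set of $\boldsymbol{Q}$-snapshots with $\boldsymbol{Q}^{\pi_k}\in\mathcal{Q}_k$. Then $\{\pi_k\}$ converges (pointwise in $(s,a,\boldsymbol{\lambda})$) to a preference-dependent policy $\pi^\ast$ such that $$\boldsymbol{\lambda}^\top\boldsymbol{Q}^{\pi^\ast}(s,a;\boldsymbol{\lambda})\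 \ge\ \boldsymbol{\lambda}^\top\boldsymbol{Q}^{\pi}(s,a)\qquad\text{for all }\pi\in\Pi,\ (s,a)\in\mathcal{S}\times\mathcal{A},\ \boldsymbol{\lambda}\in\Lambda.$$
   Context: Setting: $\mathcal{S}$ and $\mathcal{A}$ are finite sets, $\mathcal{P}(\cdot\mid s,a)$ is a transition kernel on $\mathcal{S}$, $\boldsymbol{r}:\mathcal{S}\times\mathcal{A}\to[-r_{\max},r_{\max}]^d$ is a vector-valued reward, $\gamma\in(0,1)$ is the discount factor, $\alpha>0$ is the temperature, and $\Lambda=\{\boldsymbol{\lambda}\in\mathbb{R}^d:\lambda_i\ge 0,\ \sum_i\lambda_i=1\}$. $\mathbf{1}_d$ is the all-ones vector in $\mathbb{R}^d$. $\Pi$ is the set of all stationary randomized policies $\pi:\mathcal{S}\to\Delta(\mathcal{A})$, where $\Delta(\mathcal{A})$ is the set of probability distributions on $\mathcal{A}$. A preference-dependent policy assigns to each $\boldsymbol{\lambda}\in\Lambda$ a policy $\pi(\cdot\mid\cdot;\boldsymbol{\lambda})\in\Pi$. Convention: $0\log 0=0$. Soft value functions: for $\pi\in\Pi$, $\boldsymbol{Q}^\pi:\mathcal{S}\times\mathcal{A}\to\mathbb{R}^d$ and $\boldsymbol{V}^\pi:\mathcal{S}\to\mathbb{R}^d$ are defined by the entropy-regularized Bellman equations $$\boldsymbol{Q}^\pi(s,a)=\boldsymbol{r}(s,a)+\gamma\,\mathbb{E}_{s'\sim\mathcal{P}(\cdot\mid s,a)}[\boldsymbol{V}^\pi(s')],\qquad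 \boldsymbol{V}^\pi(s)=\mathbb{E}_{a\sim\pi(\cdot\mid s)}[\boldsymbol{Q}^\pi(s,a)-\alpha\log\pi(a\mid s)\mathbf{1}_d].$$ For a preference-dependent policy $\pi$, $\boldsymbol{Q}^\pi(s,a;\boldsymbol{\lambda})$ denotes $\boldsymbol{Q}^{\pi(\cdot\mid\cdot;\boldsymbol{\lambda})}(s,a)$. Policy evaluation: in each iteration, $\boldsymbol{Q}^{\pi_k}(\cdot,\cdot;\boldsymbol{\lambda})$ is the exact soft $\boldsymbol{Q}$-function, obtained for each $\boldsymbol{\lambda}$ as the limit of iterating the operator $$(\mathcal{T}^{\pi_k}_{\mathrm{MO}}\boldsymbol{Q})(s,a;\boldsymbol{\lambda})=\boldsymbol{r}(s,a)+\gamma\,\mathbb{E}_{s'\sim\mathcal{P}(\cdot\mid s,a),\,a'\sim\pi_k(\cdot\mid s';\boldsymbol{\lambda})}[\boldsymbol{Q}(s',a';\boldsymbol{\lambda})-\alpha\log\pi_k(a'\mid s';\boldsymbol{\lambda})\mathbf{1}_d].$$ $\boldsymbol{Q}$-snapshots: at iteration $k$, the $\boldsymbol{Q}$-snapshots are the soft $\boldsymbol{Q}$-functions of the policies obtained up to that iteration, so $\mathcal{Q}_k\subseteq\{\boldsymbol{Q}^{\pi_0},\dots,\boldsymbol{Q}^{\pi_k}\}$, each viewed as a function of $(s,a;\boldsymbol{\lambda}')$. The sets $W_k(\boldsymbol{\lambda})$ and $\mathcal{Q}_k$ may vary with $k$. *)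

theory Defs
  imports "HOL-Probability.Probability"
begin

text \<open>
  The finite sets of states, actions and objectives are the universes of finite types
  \<open>'s\<close>, \<open>'a\<close> and \<open>'d\<close>; \<open>\<real>^d\<close> is \<open>real ^ 'd\<close>.  A value of type \<open>('s, 'a) policy\<close> is a stationary
  randomized policy, so this type is the policy class \<open>\<Pi>\<close>.  A preference-dependent policy is a
  total function on \<open>real ^ 'd\<close>, but only its values on \<open>unit_simplex\<close> are ever used.
\<close>

type_synonym ('s, 'a) policy = "'s \<Rightarrow> 'a pmf"
type_synonym ('s, 'a, 'd) vector_Q = "'s \<Rightarrow> 'a \<Rightarrow> real ^ 'd"
type_synonym ('s, 'a, 'd) pref_policy = "real ^ 'd \<Rightarrow> ('s, 'a) policy"
type_synonym ('s, 'a, 'd) pref_Q = "real ^ 'd \<Rightarrow> ('s, 'a, 'd) vector_Q"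

definition unit_simplex :: "(real ^ 'd) set" where
  "unit_simplex = {l. (\<forall>i. 0 \<le> l $ i) \<and> (\<Sum>i\<in>UNIV. l $ i) = 1}"

text \<open>
  The integrals below are over \<open>\<pi> s\<close>, hence only over actions of positive probability; this is the
  convention \<open>0 log 0 = 0\<close>.
\<close>

definition soft_V_of ::
    "real \<Rightarrow> ('s, 'a) policy \<Rightarrow> ('s, 'a, 'd::finite) vector_Q \<Rightarrow> 's \<Rightarrow> real ^ 'd" where
  "soft_V_of \<alpha> \<pi> Q s =
     measure_pmf.expectation (\<pi> s) (\<lambda>a. Q s a - (\<alpha> * ln (pmf (\<pi> s) a)) *\<^sub>R (\<chi> i. 1))"

definition soft_bellman ::
    "('s \<Rightarrow> 'a \<Rightarrow> 's pmf) \<Rightarrow> ('s, 'a, 'd::finite) vector_Q \<Rightarrow> real \<Rightarrow> real \<Rightarrow> ('s, 'a) policy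
      \<Rightarrow> ('s, 'a, 'd) vector_Q \<Rightarrow> ('s \<Rightarrow> real ^ 'd) \<Rightarrow> bool" where
  "soft_bellman P r \<gamma> \<alpha> \<pi> Q V \<longleftrightarrow>
     (\<forall>s a. Q s a = r s a + \<gamma> *\<^sub>R measure_pmf.expectation (P s a) V) \<and>
     (\<forall>s. V s = soft_V_of \<alpha> \<pi> Q s)"

definition soft_Q ::
    "('s \<Rightarrow> 'a \<Rightarrow> 's pmf) \<Rightarrow> ('s, 'a, 'd::finite) vector_Q \<Rightarrow> real \<Rightarrow> real \<Rightarrow> ('s, 'a) policy
      \<Rightarrow> ('s, 'a, 'd) vector_Q" where
  "soft_Q P r \<gamma> \<alpha> \<pi> = (THE Q. \<exists>V. soft_bellman P r \<gamma> \<alpha> \<pi> Q V)"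

definition pref_soft_Q ::
    "('s \<Rightarrow> 'a \<Rightarrow> 's pmf) \<Rightarrow> ('s, 'a, 'd::finite) vector_Q \<Rightarrow> real \<Rightarrow> real
      \<Rightarrow> ('s, 'a, 'd) pref_policy \<Rightarrow> ('s, 'a, 'd) pref_Q" where
  "pref_soft_Q P r \<gamma> \<alpha> \<pi> = (\<lambda>l. soft_Q P r \<gamma> \<alpha> (\<pi> l))"

text \<open>
  The policy evaluation operator.  The lemmas below show that for \<open>0 < \<gamma> < 1\<close> the Bellman equations
  determine \<open>soft_Q\<close> uniquely and that iterating the operator from any start converges to it.
\<close>

definition eval_op ::
    "('s \<Rightarrow> 'a \<Rightarrow> 's pmf) \<Rightarrow> ('s, 'a, 'd::finite) vector_Q \<Rightarrow> real \<Rightarrow> real \<Rightarrow> ('s, 'a) policy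
      \<Rightarrow> ('s, 'a, 'd) vector_Q \<Rightarrow> ('s, 'a, 'd) vector_Q" where
  "eval_op P r \<gamma> \<alpha> \<pi> Q =
     (\<lambda>s a. r s a + \<gamma> *\<^sub>R measure_pmf.expectation (P s a) (\<lambda>s'. 
        measure_pmf.expectation (\<pi> s')
          (\<lambda>a'. Q s' a' - (\<alpha> * ln (pmf (\<pi> s') a')) *\<^sub>R (\<chi> i. 1))))"

lemma eval_op_eq:
  "eval_op P r \<gamma> \<alpha> \<pi> Q =
     (\<lambda>s a. r s a + \<gamma> *\<^sub>R measure_pmf.expectation (P s a) (soft_V_of \<alpha> \<pi> Q))"
  unfolding eval_op_def soft_V_of_def[abs_def] ..

lemma soft_bellman_iff:
  "(\<exists>V. soft_bellman P r \<gamma> \<alpha> \<pi> Q V) \<longleftrightarrow> eval_op P r \<gamma> \<alpha> \<pi> Q = Q"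
proof -
  have "soft_bellman P r \<gamma> \<alpha> \<pi> Q V \<longleftrightarrow> V = soft_V_of \<alpha> \<pi> Q \<and> Q = eval_op P r \<gamma> \<alpha> \<pi> Q" for V
  proof -
    have "soft_bellman P r \<gamma> \<alpha> \<pi> Q V \<longleftrightarrow> V = soft_V_of \<alpha> \<pi> Q \<and>
        (\<forall>s a. Q s a = r s a + \<gamma> *\<^sub>R measure_pmf.expectation (P s a) V)"
      unfolding soft_bellman_def fun_eq_iff[of V] by blast
    also have "\<dots> \<longleftrightarrow> V = soft_V_of \<alpha> \<pi> Q \<and> Q = eval_op P r \<gamma> \<alpha> \<pi> Q"
      by (rule conj_cong[OF refl]) (simp only: eval_op_eq fun_eq_iff[of Q] fun_eq_iff[of "Q s" for s])
    finally show ?thesis .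
  qed
  then show ?thesis by auto
qed

context
  fixes P :: "'s::finite \<Rightarrow> 'a::finite \<Rightarrow> 's pmf" and r :: "('s, 'a, 'd::finite) vector_Q"
    and \<gamma> \<alpha> :: real and \<pi> :: "('s, 'a) policy"
  assumes \<gamma>: "0 < \<gamma>" "\<gamma> < 1"
begin

private abbreviation "T \<equiv> eval_op P r \<gamma> \<alpha> \<pi>"

private lemma integrable_finite:
  fixes f :: "'x::finite \<Rightarrow> real ^ 'd"
  shows "integrable (measure_pmf p) f"
  by (rule integrable_measure_pmf_finite) simp

private lemma expectation_norm_le:
  fixes f :: "'x::finite \<Rightarrow> real ^ 'd"
  assumes "\<And>x. norm (f x) \<le> C"
  shows "norm (measure_pmf.expectation p f) \<le> C"
proof -
  have "norm (measure_pmf.expectation p f) \<le> measure_pmf.expectation p (\<lambda>x. norm (f x))"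
    by (rule integral_norm_bound)
  also have "\<dots> \<le> measure_pmf.expectation p (\<lambda>_. C)"
    using assms by (intro integral_mono integrable_measure_pmf_finite) auto
  finally show ?thesis by simp
qed

private lemma eval_op_contraction:
  assumes "\<And>s a. norm (Q s a - Q' s a) \<le> C"
  shows "norm (T Q s a - T Q' s a) \<le> \<gamma> * C"
proof -
  have "T Q s a - T Q' s a = \<gamma> *\<^sub>R measure_pmf.expectation (P s a)
      (\<lambda>s'. measure_pmf.expectation (\<pi> s') (\<lambda>a'. Q s' a' - Q' s' a'))"
    (is "_ = \<gamma> *\<^sub>R ?E")
  proof -
    have "measure_pmf.expectation (\<pi> s') (\<lambda>a'. Q s' a' - Q' s' a') =
        soft_V_of \<alpha> \<pi> Q s' - soft_V_of \<alpha> \<pi> Q' s'" for s'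
      unfolding soft_V_of_def
      by (subst Bochner_Integration.integral_diff[symmetric]) (auto simp: integrable_finite)
    then have "?E = measure_pmf.expectation (P s a) (soft_V_of \<alpha> \<pi> Q) -
        measure_pmf.expectation (P s a) (soft_V_of \<alpha> \<pi> Q')"
      by (simp add: integrable_finite)
    then show ?thesis by (simp add: eval_op_eq scaleR_diff_right)
  qed
  also have "norm \<dots> \<le> \<gamma> * C"
    using \<gamma> assms by (simp add: expectation_norm_le)
  finally show ?thesis .
qed

private lemma eval_op_iterates:
  assumes "\<And>s a. norm (Q s a - Q' s a) \<le> C"
  shows "norm ((T ^^ n) Q s a - (T ^^ n) Q' s a) \<le> \<gamma> ^ n * C"
proof (induction n arbitrary: s a)
  case 0
  then show ?case using assms by simp
next
  case (Suc n)
  show ?case using eval_op_contraction[OF Suc] by (simp add: mult.assoc)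
qed

private lemma vector_Q_bounded: "\<exists>C. \<forall>s a. norm (Q s a - Q' s a :: real ^ 'd) \<le> C"
  for Q Q' :: "('s, 'a, 'd) vector_Q"
proof -
  have "norm (Q s a - Q' s a) \<le> (\<Sum>(s, a)\<in>UNIV. norm (Q s a - Q' s a))" for s a
    using member_le_sum[of "(s, a)" UNIV "\<lambda>(s, a). norm (Q s a - Q' s a)"] by auto
  then show ?thesis by blast
qed

private lemma eval_op_pow_tendsto:
  assumes "T Q = Q"
  shows "(\<lambda>n. (T ^^ n) Q0 s a) \<longlonglongrightarrow> Q s a"
proof -
  obtain C where C: "\<And>s a. norm (Q0 s a - Q s a) \<le> C" using vector_Q_bounded[of Q0 Q] by blast
  have fix_pow: "(T ^^ n) Q = Q" for n by (induction n) (use assms in auto)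
  have "(\<lambda>n. (T ^^ n) Q0 s a - Q s a) \<longlonglongrightarrow> 0"
  proof (rule Lim_null_comparison)
    show "\<forall>\<^sub>F n in sequentially. norm ((T ^^ n) Q0 s a - Q s a) \<le> \<gamma> ^ n * C"
      using eval_op_iterates[of Q0 Q C, OF C] by (simp add: fix_pow)
    show "(\<lambda>n. \<gamma> ^ n * C) \<longlonglongrightarrow> 0"
      using \<gamma> by (intro tendsto_mult_left_zero LIMSEQ_realpow_zero) auto
  qed
  then show ?thesis by (simp add: LIM_zero_iff)
qed

private lemma eval_op_continuous:
  assumes L: "\<And>s a. (\<lambda>n. X n s a) \<longlonglongrightarrow> L s a"
  shows "(\<lambda>n. T (X n) s a) \<longlonglongrightarrow> T L s a"
  unfolding eval_op_def integral_measure_pmf[OF finite UNIV_I]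
  by (intro tendsto_add tendsto_scaleR tendsto_sum tendsto_diff tendsto_const L)

private lemma eval_op_has_fixpoint: "\<exists>Q. T Q = Q"
proof -
  let ?Q = "\<lambda>n. (T ^^ n) (\<lambda>_ _. 0)"
  obtain C where C: "\<And>s a. norm (?Q 1 s a - ?Q 0 s a) \<le> C"
    using vector_Q_bounded[of "?Q 1" "?Q 0"] by blast
  have step: "norm (?Q (Suc n) s a - ?Q n s a) \<le> \<gamma> ^ n * C" for n s a
    using eval_op_iterates[of "?Q 1" "?Q 0" C n s a, OF C] by (simp add: funpow_swap1)
  have "summable (\<lambda>n. ?Q (Suc n) s a - ?Q n s a)" for s a
    using \<gamma> by (intro summable_comparison_test'[OF _ step] summable_mult2 summable_geometric) auto
  then have "(\<lambda>n. \<Sum>i<n. ?Q (Suc i) s a - ?Q i s a)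
      \<longlonglongrightarrow> (\<Sum>i. ?Q (Suc i) s a - ?Q i s a)" for s a
    by (rule summable_LIMSEQ)
  moreover have "(\<Sum>i<n. ?Q (Suc i) s a - ?Q i s a) = ?Q n s a" for n s a
    by (subst sum_lessThan_telescope) simp
  ultimately have "(\<lambda>n. ?Q n s a) \<longlonglongrightarrow> (\<Sum>i. ?Q (Suc i) s a - ?Q i s a)" for s a
    by (simp only:)
  then obtain L where L: "\<And>s a. (\<lambda>n. ?Q n s a) \<longlonglongrightarrow> L s a" by (rule that)
  have "(\<lambda>n. T (?Q n) s a) \<longlonglongrightarrow> T L s a" for s a
    using L by (rule eval_op_continuous)
  moreover have "(\<lambda>n. T (?Q n) s a) \<longlonglongrightarrow> L s a" for s a
    using L[of s a, THEN LIMSEQ_Suc] by simp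
  ultimately have "T L = L" by (intro ext) (rule LIMSEQ_unique)
  then show ?thesis by (rule exI[of _ L])
qed

lemma ex1_soft_bellman: "\<exists>!Q. \<exists>V. soft_bellman P r \<gamma> \<alpha> \<pi> Q V"
proof -
  have "Q = Q'" if "T Q = Q" "T Q' = Q'" for Q Q'
    using LIMSEQ_unique[OF eval_op_pow_tendsto[OF that(1)] eval_op_pow_tendsto[OF that(2)]]
    by (intro ext)
  then show ?thesis unfolding soft_bellman_iff using eval_op_has_fixpoint by blast
qed

lemma soft_bellman_soft_Q: "\<exists>V. soft_bellman P r \<gamma> \<alpha> \<pi> (soft_Q P r \<gamma> \<alpha> \<pi>) V"
  unfolding soft_Q_def by (rule theI'[OF ex1_soft_bellman])

lemma eval_op_tendsto_soft_Q:
  "(\<lambda>n. (eval_op P r \<gamma> \<alpha> \<pi> ^^ n) Q0 s a) \<longlonglongrightarrow> soft_Q P r \<gamma> \<alpha> \<pi> s a"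
  using eval_op_pow_tendsto soft_bellman_soft_Q soft_bellman_iff by metis

end

definition pensieve_weight ::
    "real \<Rightarrow> (real ^ 'd::finite) set \<Rightarrow> ('s, 'a, 'd) pref_Q set \<Rightarrow> real ^ 'd \<Rightarrow> 's \<Rightarrow> 'a \<Rightarrow> real" where
  "pensieve_weight \<alpha> W \<Q> l s a = exp (SUP (l', Q') \<in> W \<times> \<Q>. (1 / \<alpha>) * (l \<bullet> Q' l' s a))"

definition pensieve_target ::
    "real \<Rightarrow> (real ^ 'd::finite) set \<Rightarrow> ('s, 'a::finite, 'd) pref_Q set \<Rightarrow> real ^ 'd \<Rightarrow> 's \<Rightarrow> 'a pmf"
  where
  "pensieve_target \<alpha> W \<Q> l s =
     embed_pmf (\<lambda>a. pensieve_weight \<alpha> W \<Q> l s a / (\<Sum>b\<in>UNIV. pensieve_weight \<alpha> W \<Q> l s b))"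

lemma pmf_pensieve_target:
  "pmf (pensieve_target \<alpha> W \<Q> l s) a =
     pensieve_weight \<alpha> W \<Q> l s a / (\<Sum>b\<in>UNIV. pensieve_weight \<alpha> W \<Q> l s b)"
proof -
  let ?w = "pensieve_weight \<alpha> W \<Q> l s"
  have pos: "0 < ?w b" for b by (simp add: pensieve_weight_def)
  then have Z: "0 < sum ?w UNIV" by (intro sum_pos) auto
  have "(\<Sum>b\<in>UNIV. ?w b / sum ?w UNIV) = 1"
    using Z by (simp add: sum_divide_distrib[symmetric])
  then have "(\<integral>\<^sup>+b. ennreal (?w b / sum ?w UNIV) \<partial>count_space UNIV) = 1"
    using pos Z by (simp add: nn_integral_count_space_finite sum_ennreal less_imp_le)
  then show ?thesis
    unfolding pensieve_target_def using pos Z by (subst pmf_embed_pmf) (auto simp: less_imp_le)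
qed

text \<open>
  \<open>KL_divergence b M N\<close> takes the reference measure first and is the divergence of \<open>N\<close> from \<open>M\<close>,
  so \<open>KL_pmf p q\<close> is \<open>D_KL(p || q)\<close> with natural logarithms.
\<close>

definition KL_pmf :: "'a pmf \<Rightarrow> 'a pmf \<Rightarrow> real" where
  "KL_pmf p q = KL_divergence (exp 1) (measure_pmf q) (measure_pmf p)"

lemma KL_pmf_eq_sum:
  fixes p q :: "'a::finite pmf"
  assumes "\<And>a. pmf q a = 0 \<Longrightarrow> pmf p a = 0"
  shows "KL_pmf p q = (\<Sum>a\<in>UNIV. pmf p a * ln (pmf p a / pmf q a))"
proof -
  interpret sigma_finite_measure "count_space (UNIV :: 'a set)"
    by (rule sigma_finite_measure_count_space_finite) simp
  have "KL_pmf p q = (\<integral>a. pmf p a * log (exp 1) (pmf p a / pmf q a) \<partial>count_space UNIV)"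
    unfolding KL_pmf_def measure_pmf_eq_density
    by (rule KL_density_density) (use assms in \<open>auto simp: AE_count_space\<close>)
  then show ?thesis
    by (simp add: lebesgue_integral_count_space_finite log_def)
qed

text \<open>
  \<open>\<pi>\<close> is the sequence of policies, \<open>W k l\<close> the set of preferences and \<open>\<Q> k\<close> the set of snapshots used
  in iteration \<open>k\<close>.  The supremum in \<open>pensieve_weight\<close> is over a set that is nonempty and, as the soft
  Q-functions are uniformly bounded over all policies, bounded.
\<close>

definition pensieve_iteration ::
    "('s \<Rightarrow> 'a::finite \<Rightarrow> 's pmf) \<Rightarrow> ('s, 'a, 'd::finite) vector_Q \<Rightarrow> real \<Rightarrow> real
      \<Rightarrow> (nat \<Rightarrow> real ^ 'd \<Rightarrow> (real ^ 'd) set) \<Rightarrow> (nat \<Rightarrow> ('s, 'a, 'd) pref_Q set)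
      \<Rightarrow> (nat \<Rightarrow> ('s, 'a, 'd) pref_policy) \<Rightarrow> bool" where
  "pensieve_iteration P r \<gamma> \<alpha> W \<Q> \<pi> \<longleftrightarrow>
     (\<forall>k. \<forall>l\<in>unit_simplex. l \<in> W k l \<and> W k l \<subseteq> unit_simplex) \<and>
     (\<forall>k. pref_soft_Q P r \<gamma> \<alpha> (\<pi> k) \<in> \<Q> k \<and> \<Q> k \<subseteq> {pref_soft_Q P r \<gamma> \<alpha> (\<pi> j) |j. j \<le> k}) \<and>
     (\<forall>k. \<forall>l\<in>unit_simplex. \<forall>s.
        is_arg_min (\<lambda>\<pi>' :: ('s, 'a) policy. KL_pmf (\<pi>' s) (pensieve_target \<alpha> (W k l) (\<Q> k) l s))
          (\<lambda>_. True) (\<pi> (Suc k) l))"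

end

theory Submission
  imports Defs
begin

text \<open>
  Fix a preference \<open>l\<close> and scalarize all Q-functions by the inner product with \<open>l\<close>; as \<open>l\<close> sums to
  one, this turns the vector Bellman equations into ordinary soft Bellman equations.  Write \<open>T\<^sup>p\<close> for
  the evaluation operator of a policy \<open>p\<close>, \<open>T\<close> for the pointwise supremum of all \<open>T\<^sup>p\<close> (a
  log-sum-exp), \<open>q\<^sub>k\<close> for the scalarized Q-function of \<open>\<pi>\<^sub>k\<close> and \<open>u\<^sub>k\<close> for the supremum over snapshots
  and preferences.  By the Gibbs inequality \<open>\<pi>\<^sub>k\<^sub>+\<^sub>1\<close> is the softmax of \<open>u\<^sub>k / \<alpha>\<close>, so its evaluation
  operator agrees with \<open>T\<close> at \<open>u\<^sub>k\<close>.  Each function in the supremum is a fixed point of some \<open>T\<^sup>p\<close>,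
  whence \<open>u\<^sub>k \<le> T u\<^sub>k\<close>, and iterating the evaluation operator of \<open>\<pi>\<^sub>k\<^sub>+\<^sub>1\<close> from \<open>u\<^sub>k\<close> gives
  \<open>q\<^sub>k \<le> u\<^sub>k \<le> T u\<^sub>k \<le> q\<^sub>k\<^sub>+\<^sub>1\<close>.  So \<open>q\<^sub>k\<close> and \<open>u\<^sub>k\<close> increase to a common limit \<open>L\<close> with \<open>T L = L\<close>, and
  \<open>\<pi>\<^sub>k\<close> converges to the softmax of \<open>L / \<alpha>\<close>, which is optimal because \<open>T\<^sup>p L \<le> T L = L\<close> for all \<open>p\<close>.
\<close>

section \<open>The Gibbs inequality for finite distributions\<close>

text \<open>For positive \<open>x\<close> this is \<open>ln z \<le> z - 1\<close> at
  \<open>z = y / x\<close>, with equality only at \<open>z = 1\<close>.\<close>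

lemma mult_ln_divide_ge_diff:
  fixes x y :: real
  assumes "0 \<le> x" "0 < y"
  shows "x - y \<le> x * ln (x / y)"
    and "x * ln (x / y) = x - y \<longleftrightarrow> x = y"
proof -
  have "x - y \<le> x * ln (x / y) \<and> (x * ln (x / y) = x - y \<longleftrightarrow> x = y)"
  proof (cases "x = 0")
    case True
    then show ?thesis using assms by auto
  next
    case False
    then have x: "0 < x" using assms by simp
    have eq: "x * ln (x / y) - (x - y) = x * ((y / x - 1) - ln (y / x))"
      using x assms(2) by (simp add: ln_div field_simps)
    have "ln (y / x) \<le> y / x - 1"
      using x assms(2) by (intro ln_le_minus_one) simp
    then have ge: "0 \<le> x * ((y / x - 1) - ln (y / x))" using x by simp
    have "x * ln (x / y) = x - y \<longleftrightarrow> x * ((y / x - 1) - ln (y / x)) = 0"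
      unfolding eq[symmetric] by auto
    also have "\<dots> \<longleftrightarrow> y / x = 1"
      using x assms(2) ln_eq_minus_one[of "y / x"] by auto
    finally show ?thesis using ge eq x by auto
  qed
  then show "x - y \<le> x * ln (x / y)" and "x * ln (x / y) = x - y \<longleftrightarrow> x = y" by auto
qed

lemma
  fixes p q :: "'a::finite pmf"
  assumes q: "\<And>a. 0 < pmf q a"
  shows KL_pmf_nonneg: "0 \<le> KL_pmf p q"
    and KL_pmf_eq_0_iff: "KL_pmf p q = 0 \<longleftrightarrow> p = q"
proof -
  have "KL_pmf p q = (\<Sum>a\<in>UNIV. pmf p a * ln (pmf p a / pmf q a))"
    using q by (intro KL_pmf_eq_sum) (metis less_irrefl)
  \<comment> \<open>Both masses sum to one, so the correction vanishes in total while making each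
    summand nonnegative; the equality case can then be read off termwise.\<close>
  also have "\<dots> = (\<Sum>a\<in>UNIV. pmf p a * ln (pmf p a / pmf q a) - (pmf p a - pmf q a))"
    by (simp add: sum_subtractf sum_pmf_eq_1)
  finally have KL: "KL_pmf p q =
    (\<Sum>a\<in>UNIV. pmf p a * ln (pmf p a / pmf q a) - (pmf p a - pmf q a))" .
  have ge: "0 \<le> pmf p a * ln (pmf p a / pmf q a) - (pmf p a - pmf q a)" for a
    using mult_ln_divide_ge_diff(1)[OF pmf_nonneg q, of p a a] by simp
  show "0 \<le> KL_pmf p q" unfolding KL by (intro sum_nonneg ge)
  have "KL_pmf p q = 0 \<longleftrightarrow> (\<forall>a. pmf p a = pmf q a)"
    unfolding KL using mult_ln_divide_ge_diff(2)[OF pmf_nonneg q, of p]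
    by (subst sum_nonneg_eq_0_iff[OF finite ge]) auto
  then show "KL_pmf p q = 0 \<longleftrightarrow> p = q" by (auto intro: pmf_eqI)
qed

section \<open>Softmax, log-sum-exp and the entropy-regularized value\<close>

definition softmax :: "('a::finite \<Rightarrow> real) \<Rightarrow> 'a pmf" where
  "softmax x = embed_pmf (\<lambda>a. exp (x a) / (\<Sum>b\<in>UNIV. exp (x b)))"

definition log_sum_exp :: "('a::finite \<Rightarrow> real) \<Rightarrow> real" where
  "log_sum_exp x = ln (\<Sum>a\<in>UNIV. exp (x a))"

lemma sum_exp_pos: "0 < (\<Sum>a\<in>UNIV. exp (x a :: real))" for x :: "'a::finite \<Rightarrow> real"
  by (intro sum_pos) auto

lemma pmf_softmax: "pmf (softmax x) a = exp (x a) / (\<Sum>b\<in>UNIV. exp (x b))"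
proof -
  have "(\<Sum>b\<in>UNIV. exp (x b) / (\<Sum>b\<in>UNIV. exp (x b))) = 1"
    using sum_exp_pos[of x] by (simp add: sum_divide_distrib[symmetric])
  then have "(\<integral>\<^sup>+b. ennreal (exp (x b) / (\<Sum>b\<in>UNIV. exp (x b))) \<partial>count_space UNIV) = 1"
    using sum_exp_pos[of x] by (simp add: nn_integral_count_space_finite sum_ennreal less_imp_le)
  then show ?thesis
    unfolding softmax_def using sum_exp_pos[of x]
    by (subst pmf_embed_pmf) (auto simp: less_imp_le)
qed

lemma pmf_softmax_pos: "0 < pmf (softmax x) a"
  by (simp add: pmf_softmax sum_exp_pos)

lemma tendsto_pmf_softmax:
  assumes "\<And>a. (\<lambda>k. x k a) \<longlonglongrightarrow> y a"
  shows "(\<lambda>k. pmf (softmax (x k)) a) \<longlonglongrightarrow> pmf (softmax y) a"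
  unfolding pmf_softmax
  by (intro tendsto_divide tendsto_sum tendsto_exp assms) (use sum_exp_pos[of y] in simp)

lemma pensieve_target_eq_softmax:
  "pensieve_target \<alpha> W \<Q> l s =
     softmax (\<lambda>a. SUP (l', Q') \<in> W \<times> \<Q>. (1 / \<alpha>) * (l \<bullet> Q' l' s a))"
  by (rule pmf_eqI) (simp add: pmf_pensieve_target pmf_softmax pensieve_weight_def)

lemma log_sum_exp_mono:
  assumes "\<And>a. x a \<le> y a"
  shows "log_sum_exp x \<le> log_sum_exp y"
  unfolding log_sum_exp_def using assms
  by (subst ln_le_cancel_iff) (auto intro!: sum_pos sum_mono)

lemma tendsto_log_sum_exp:
  assumes "\<And>a. (\<lambda>k. x k a) \<longlonglongrightarrow> y a"
  shows "(\<lambda>k. log_sum_exp (x k)) \<longlonglongrightarrow> log_sum_exp y"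
  unfolding log_sum_exp_def
  by (intro tendsto_ln tendsto_sum tendsto_exp assms) (use sum_exp_pos[of y] in simp)

text \<open>The factor \<open>pmf p a\<close> kills the summand at actions of probability zero, so
  summing over all actions respects the convention for \<open>0 log 0\<close>.\<close>

definition soft_value :: "real \<Rightarrow> 'a::finite pmf \<Rightarrow> ('a \<Rightarrow> real) \<Rightarrow> real" where
  "soft_value \<alpha> p x = (\<Sum>a\<in>UNIV. pmf p a * (x a - \<alpha> * ln (pmf p a)))"

lemma soft_value_mono:
  assumes "\<And>a. x a \<le> y a"
  shows "soft_value \<alpha> p x \<le> soft_value \<alpha> p y"
  unfolding soft_value_def by (intro sum_mono mult_left_mono diff_right_mono assms) simp

text \<open>Gibbs variational identity: the logarithm of the softmax is
  \<open>x a / \<alpha>\<close> minus the log-sum-exp. It gives both the maximum of the regularized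
  value and its maximizer.\<close>

lemma soft_value_eq_KL_pmf:
  assumes "0 < \<alpha>"
  shows "soft_value \<alpha> p x =
    \<alpha> * log_sum_exp (\<lambda>a. x a / \<alpha>) - \<alpha> * KL_pmf p (softmax (\<lambda>a. x a / \<alpha>))"
proof -
  let ?q = "softmax (\<lambda>a. x a / \<alpha>)"
  have term_eq: "\<alpha> * (pmf p a * ln (pmf p a / pmf ?q a)) =
      pmf p a * (\<alpha> * log_sum_exp (\<lambda>a. x a / \<alpha>)) - pmf p a * (x a - \<alpha> * ln (pmf p a))" for a
  proof (cases "pmf p a = 0")
    case False
    then have p: "0 < pmf p a" by (simp add: pmf_positive_iff set_pmf_iff)
    have "x a = \<alpha> * (ln (pmf ?q a) + log_sum_exp (\<lambda>a. x a / \<alpha>))"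
      using assms unfolding pmf_softmax log_sum_exp_def using sum_exp_pos[of "\<lambda>a. x a / \<alpha>"]
      by (subst ln_div) auto
    then have "pmf p a * x a = pmf p a * (\<alpha> * (ln (pmf ?q a) + log_sum_exp (\<lambda>a. x a / \<alpha>)))"
      by (rule arg_cong)
    then show ?thesis using p pmf_softmax_pos[of "\<lambda>a. x a / \<alpha>" a]
      by (simp add: ln_div algebra_simps)
  qed simp
  have "KL_pmf p ?q = (\<Sum>a\<in>UNIV. pmf p a * ln (pmf p a / pmf ?q a))"
    by (rule KL_pmf_eq_sum) (metis less_irrefl pmf_softmax_pos)
  then have "\<alpha> * KL_pmf p ?q = (\<Sum>a\<in>UNIV. pmf p a * (\<alpha> * log_sum_exp (\<lambda>a. x a / \<alpha>))) -
      soft_value \<alpha> p x"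
    by (simp only: sum_distrib_left term_eq sum_subtractf soft_value_def)
  also have "(\<Sum>a\<in>UNIV. pmf p a * (\<alpha> * log_sum_exp (\<lambda>a. x a / \<alpha>))) =
      \<alpha> * log_sum_exp (\<lambda>a. x a / \<alpha>)"
    by (simp only: sum_distrib_right[symmetric] sum_pmf_eq_1[OF finite subset_UNIV] mult_1)
  finally show ?thesis by simp
qed

lemma soft_value_le_log_sum_exp:
  assumes "0 < \<alpha>"
  shows "soft_value \<alpha> p x \<le> \<alpha> * log_sum_exp (\<lambda>a. x a / \<alpha>)"
  using assms by (simp add: soft_value_eq_KL_pmf KL_pmf_nonneg pmf_softmax_pos)

lemma soft_value_softmax:
  assumes "0 < \<alpha>"
  shows "soft_value \<alpha> (softmax (\<lambda>a. x a / \<alpha>)) x = \<alpha> * log_sum_exp (\<lambda>a. x a / \<alpha>)"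
  using assms by (simp add: soft_value_eq_KL_pmf KL_pmf_eq_0_iff pmf_softmax_pos)

section \<open>Scalarization and its Bellman operators\<close>

lemma inner_one_unit_simplex: "l \<in> unit_simplex \<Longrightarrow> l \<bullet> (\<chi> i. 1) = 1"
  by (simp add: unit_simplex_def inner_vec_def)

lemma inner_le_unit_simplex:
  assumes "l \<in> unit_simplex" and "\<And>i. x $ i \<le> c"
  shows "l \<bullet> x \<le> c"
proof -
  have "l \<bullet> x \<le> (\<Sum>i\<in>UNIV. l $ i * c)"
    using assms by (auto simp: inner_vec_def unit_simplex_def intro!: sum_mono mult_left_mono)
  then show ?thesis using assms(1) by (simp add: unit_simplex_def flip: sum_distrib_right)
qed

locale scalarized_soft_mdp =
  fixes P :: "'s::finite \<Rightarrow> 'a::finite \<Rightarrow> 's pmf"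
    and r :: "('s, 'a, 'd::finite) vector_Q"
    and \<gamma> \<alpha> :: real and l :: "real ^ 'd"
  assumes \<gamma>: "0 < \<gamma>" "\<gamma> < 1" and \<alpha>: "0 < \<alpha>" and l: "l \<in> unit_simplex"
begin

definition backup :: "('s \<Rightarrow> real) \<Rightarrow> 's \<Rightarrow> 'a \<Rightarrow> real" where
  "backup v s a = l \<bullet> r s a + \<gamma> * (\<Sum>s'\<in>UNIV. pmf (P s a) s' * v s')"

definition policy_backup :: "('s, 'a) policy \<Rightarrow> ('s \<Rightarrow> 'a \<Rightarrow> real) \<Rightarrow> 's \<Rightarrow> 'a \<Rightarrow> real" where
  "policy_backup p f = backup (\<lambda>s. soft_value \<alpha> (p s) (f s))"

text \<open>The soft Bellman optimality operator: the state value is the maximum of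
  \<open>soft_value\<close> over action distributions.\<close>

definition optimal_backup :: "('s \<Rightarrow> 'a \<Rightarrow> real) \<Rightarrow> 's \<Rightarrow> 'a \<Rightarrow> real" where
  "optimal_backup f = backup (\<lambda>s. \<alpha> * log_sum_exp (\<lambda>a. f s a / \<alpha>))"

definition scalar_Q :: "('s, 'a) policy \<Rightarrow> 's \<Rightarrow> 'a \<Rightarrow> real" where
  "scalar_Q p s a = l \<bullet> soft_Q P r \<gamma> \<alpha> p s a"

lemma backup_mono:
  assumes "\<And>s. v s \<le> w s"
  shows "backup v s a \<le> backup w s a"
  unfolding backup_def using \<gamma> assms
  by (auto intro!: sum_mono mult_left_mono)

lemma policy_backup_mono:
  "(\<And>s a. f s a \<le> g s a) \<Longrightarrow> policy_backup p f s a \<le> policy_backup p g s a"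
  unfolding policy_backup_def by (intro backup_mono soft_value_mono)

lemma policy_backup_le_optimal_backup: "policy_backup p f s a \<le> optimal_backup f s a"
  unfolding policy_backup_def optimal_backup_def
  by (intro backup_mono soft_value_le_log_sum_exp \<alpha>)

lemma policy_backup_softmax:
  assumes "\<And>s. p s = softmax (\<lambda>a. f s a / \<alpha>)"
  shows "policy_backup p f = optimal_backup f"
  unfolding policy_backup_def optimal_backup_def by (simp add: assms soft_value_softmax \<alpha>)

lemma tendsto_optimal_backup:
  assumes "\<And>s a. (\<lambda>k. f k s a) \<longlonglongrightarrow> g s a"
  shows "(\<lambda>k. optimal_backup (f k) s a) \<longlonglongrightarrow> optimal_backup g s a"
  unfolding optimal_backup_def backup_def
  by (intro tendsto_intros tendsto_log_sum_exp assms) (use \<alpha> in simp)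

text \<open>The entropy bonus is equal in all objectives and the entries of \<open>l\<close> sum to
  one, so scalarization leaves the bonus unchanged.\<close>

lemma inner_eval_op:
  "l \<bullet> eval_op P r \<gamma> \<alpha> p Q s a = policy_backup p (\<lambda>s a. l \<bullet> Q s a) s a"
  unfolding eval_op_def policy_backup_def backup_def soft_value_def
    integral_measure_pmf[OF finite UNIV_I]
  by (simp add: inner_add_right inner_sum_right inner_diff_right inner_one_unit_simplex[OF l])

lemma inner_eval_op_funpow:
  "(\<lambda>s a. l \<bullet> (eval_op P r \<gamma> \<alpha> p ^^ n) Q s a) = (policy_backup p ^^ n) (\<lambda>s a. l \<bullet> Q s a)"
  by (induction n) (simp_all add: inner_eval_op)

lemma policy_backup_scalar_Q: "policy_backup p (scalar_Q p) = scalar_Q p"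
proof -
  have "eval_op P r \<gamma> \<alpha> p (soft_Q P r \<gamma> \<alpha> p) = soft_Q P r \<gamma> \<alpha> p"
    using soft_bellman_soft_Q[OF \<gamma>] by (rule soft_bellman_iff[THEN iffD1])
  then have "policy_backup p (scalar_Q p) s a = scalar_Q p s a" for s a
    using inner_eval_op[of p "soft_Q P r \<gamma> \<alpha> p" s a] by (simp only: scalar_Q_def[abs_def])
  then show ?thesis by (intro ext)
qed

lemma policy_backup_tendsto_scalar_Q:
  "(\<lambda>n. (policy_backup p ^^ n) f s a) \<longlonglongrightarrow> scalar_Q p s a"
proof -
  \<comment> \<open>Every coordinate of this vector start is \<open>f\<close>, so its inner product
    with \<open>l\<close> is \<open>f\<close> again and convergence carries over to an arbitrary
    scalar start.\<close>
  let ?Q = "\<lambda>s a. f s a *\<^sub>R ((\<chi> i. 1) :: real ^ 'd)"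
  have "(\<lambda>n. l \<bullet> (eval_op P r \<gamma> \<alpha> p ^^ n) ?Q s a) \<longlonglongrightarrow> scalar_Q p s a"
    unfolding scalar_Q_def by (intro tendsto_intros eval_op_tendsto_soft_Q \<gamma>)
  moreover have "l \<bullet> (eval_op P r \<gamma> \<alpha> p ^^ n) ?Q s a = (policy_backup p ^^ n) f s a" for n
    using fun_cong[OF fun_cong[OF inner_eval_op_funpow[of n p ?Q]], of s a]
    by (simp add: inner_one_unit_simplex[OF l])
  ultimately show ?thesis by simp
qed

section \<open>Comparison principle and uniform bound\<close>

text \<open>By monotonicity all iterates from a subsolution stay above it, and they converge to the
  fixed point. The dual for supersolutions follows.\<close>

lemma le_scalar_Q:
  assumes "\<And>s a. f s a \<le> policy_backup p f s a"
  shows "f s a \<le> scalar_Q p s a"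
proof (rule LIMSEQ_le_const[OF policy_backup_tendsto_scalar_Q])
  have "f s a \<le> (policy_backup p ^^ n) f s a" for n s a
  proof (induction n arbitrary: s a)
    case (Suc n)
    have "f s a \<le> policy_backup p f s a" by (rule assms)
    also have "\<dots> \<le> policy_backup p ((policy_backup p ^^ n) f) s a"
      by (intro policy_backup_mono Suc)
    finally show ?case by simp
  qed simp
  then show "\<exists>N. \<forall>n\<ge>N. f s a \<le> (policy_backup p ^^ n) f s a" by blast
qed

lemma scalar_Q_le:
  assumes "\<And>s a. policy_backup p f s a \<le> f s a"
  shows "scalar_Q p s a \<le> f s a"
proof (rule LIMSEQ_le_const2[OF policy_backup_tendsto_scalar_Q])
  have "(policy_backup p ^^ n) f s a \<le> f s a" for n s a
  proof (induction n arbitrary: s a)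
    case (Suc n)
    have "policy_backup p ((policy_backup p ^^ n) f) s a \<le> policy_backup p f s a"
      by (intro policy_backup_mono Suc)
    also have "\<dots> \<le> f s a" by (rule assms)
    finally show ?case by simp
  qed simp
  then show "\<exists>N. \<forall>n\<ge>N. (policy_backup p ^^ n) f s a \<le> f s a" by blast
qed

text \<open>The bound solves \<open>B = M + \<gamma> * (\<alpha> * ln (CARD('a)) + B)\<close>, where
  \<open>ln (CARD('a))\<close> is the largest entropy, so the constant \<open>B\<close> is a
  supersolution for every policy.\<close>

lemma scalar_Q_bounded:
  assumes "\<And>s a. l \<bullet> r s a \<le> M"
  shows "scalar_Q p s a \<le> (M + \<gamma> * \<alpha> * ln (CARD('a))) / (1 - \<gamma>)" (is "_ \<le> ?B")
proof (rule scalar_Q_le)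
  fix s a
  have scale: "\<alpha> * (x + b / \<alpha>) = \<alpha> * x + b" for x b
    using \<alpha> by (simp add: distrib_left)
  have "log_sum_exp (\<lambda>a::'a. ?B / \<alpha>) = ln (CARD('a)) + ?B / \<alpha>"
    by (simp add: log_sum_exp_def ln_mult)
  then have "optimal_backup (\<lambda>_ _. ?B) s a = l \<bullet> r s a + \<gamma> * (\<alpha> * (ln (CARD('a)) + ?B / \<alpha>))"
    by (simp add: optimal_backup_def backup_def sum_pmf_eq_1 flip: sum_distrib_right)
  also have "\<dots> \<le> M + \<gamma> * \<alpha> * ln (CARD('a)) + \<gamma> * ?B"
    using assms[of s a] scale[of "ln (CARD('a))" ?B] by (simp add: distrib_left mult.assoc)
  also have "\<dots> = ?B"
    using \<gamma> by (simp add: field_simps)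
  finally show "policy_backup p (\<lambda>_ _. ?B) s a \<le> ?B"
    using policy_backup_le_optimal_backup order_trans by blast
qed

section \<open>Optimistic policy improvement and its limit\<close>

text \<open>Snapshots and preferences enter only through a set \<open>S\<close> of policies. The
  factor \<open>\<alpha>\<close> in \<open>u\<close> undoes the division inside the softmax.\<close>

lemma optimal_backup_sup_le:
  assumes mem: "p0 \<in> S" and bdd: "\<And>p s a. scalar_Q p s a \<le> B"
    and p': "\<And>s. p' s = softmax (\<lambda>a. SUP p\<in>S. scalar_Q p s a / \<alpha>)"
  defines "u \<equiv> \<lambda>s a. \<alpha> * (SUP p\<in>S. scalar_Q p s a / \<alpha>)"
  shows "scalar_Q p0 s a \<le> u s a" and "u s a \<le> optimal_backup u s a"
    and "optimal_backup u s a \<le> scalar_Q p' s a"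
proof -
  \<comment> \<open>A real supremum is known to be an upper bound only for a set bounded
    above.\<close>
  have bdd_above: "bdd_above ((\<lambda>p. scalar_Q p s a / \<alpha>) ` S)" for s a
    using bdd \<alpha> by (intro bdd_aboveI2[of _ _ "B / \<alpha>"] divide_right_mono) auto
  have le_u: "scalar_Q p s a \<le> u s a" if "p \<in> S" for p s a
    using cSUP_upper[OF that bdd_above, of s a] \<alpha> by (simp add: u_def field_simps)
  then show "scalar_Q p0 s a \<le> u s a" using mem .
  have u_le: "u s a \<le> optimal_backup u s a" for s a
  proof -
    have "scalar_Q p s a / \<alpha> \<le> optimal_backup u s a / \<alpha>" if "p \<in> S" for p
    proof -
      have "scalar_Q p s a = policy_backup p (scalar_Q p) s a"
        by (simp add: policy_backup_scalar_Q)
      also have "\<dots> \<le> policy_backup p u s a"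
        by (intro policy_backup_mono le_u that)
      also have "\<dots> \<le> optimal_backup u s a" by (rule policy_backup_le_optimal_backup)
      finally show ?thesis using \<alpha> by (simp add: divide_right_mono)
    qed
    then have "(SUP p\<in>S. scalar_Q p s a / \<alpha>) \<le> optimal_backup u s a / \<alpha>"
      using mem by (intro cSUP_least) auto
    then show ?thesis using \<alpha> by (simp add: u_def field_simps)
  qed
  then show "u s a \<le> optimal_backup u s a" .
  have eq: "policy_backup p' u = optimal_backup u"
    using p' \<alpha> by (intro policy_backup_softmax) (simp add: u_def)
  \<comment> \<open>One more application of the operator of \<open>p'\<close> sharpens the lower
    bound for \<open>scalar_Q p'\<close> from \<open>u\<close> to
    \<open>optimal_backup u\<close>.\<close>
  have "policy_backup p' u s a \<le> policy_backup p' (scalar_Q p') s a"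
    using u_le by (intro policy_backup_mono le_scalar_Q) (simp add: eq)
  then show "optimal_backup u s a \<le> scalar_Q p' s a"
    by (simp add: eq policy_backup_scalar_Q)
qed

text \<open>Monotonicity comes from \<open>p k\<close> itself lying in \<open>S k\<close>, so the
  sets may change arbitrarily between steps.\<close>

lemma optimistic_soft_policy_iteration_converges:
  assumes mem: "\<And>k. p k \<in> S k" and bdd: "\<And>q s a. scalar_Q q s a \<le> B"
    and step: "\<And>k s. p (Suc k) s = softmax (\<lambda>a. SUP q\<in>S k. scalar_Q q s a / \<alpha>)"
  shows "\<exists>p_star. (\<forall>s a. (\<lambda>k. pmf (p k s) a) \<longlonglongrightarrow> pmf (p_star s) a) \<and>
    (\<forall>q s a. scalar_Q q s a \<le> scalar_Q p_star s a)"
proof -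
  define u where "u k = (\<lambda>s a. \<alpha> * (SUP q\<in>S k. scalar_Q q s a / \<alpha>))" for k
  have q_le_u: "scalar_Q (p k) s a \<le> u k s a"
    and u_le_T: "u k s a \<le> optimal_backup (u k) s a"
    and T_le_q: "optimal_backup (u k) s a \<le> scalar_Q (p (Suc k)) s a" for k s a
    unfolding u_def by (rule optimal_backup_sup_le[OF mem bdd step])+
  have u_le_q: "u k s a \<le> scalar_Q (p (Suc k)) s a" for k s a
    using u_le_T T_le_q by (rule order_trans)
  define L where "L s a = lim (\<lambda>k. scalar_Q (p k) s a)" for s a
  have q_lim: "(\<lambda>k. scalar_Q (p k) s a) \<longlonglongrightarrow> L s a" for s a
  proof -
    have "incseq (\<lambda>k. scalar_Q (p k) s a)"
      using q_le_u u_le_q by (intro incseq_SucI) (rule order_trans)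
    then obtain y where "(\<lambda>k. scalar_Q (p k) s a) \<longlonglongrightarrow> y"
      by (rule incseq_convergent) (use bdd in auto)
    then show ?thesis unfolding L_def by (simp add: limI)
  qed
  have u_lim: "(\<lambda>k. u k s a) \<longlonglongrightarrow> L s a" for s a
  proof (rule tendsto_sandwich[OF _ _ q_lim LIMSEQ_Suc[OF q_lim]])
    show "\<forall>\<^sub>F k in sequentially. scalar_Q (p k) s a \<le> u k s a" using q_le_u by simp
    show "\<forall>\<^sub>F k in sequentially. u k s a \<le> scalar_Q (p (Suc k)) s a"
      using u_le_q by simp
  qed
  \<comment> \<open>The bounds \<open>T_le_q\<close> and \<open>u_le_T\<close> pass to the limit as
    the two halves of the fixed-point equation.\<close>
  have "optimal_backup L s a = L s a" for s a
  proof (rule antisym)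
    show "optimal_backup L s a \<le> L s a"
      using tendsto_optimal_backup[OF u_lim] LIMSEQ_Suc[OF q_lim]
      by (rule LIMSEQ_le) (use T_le_q in blast)
    show "L s a \<le> optimal_backup L s a"
      using u_lim tendsto_optimal_backup[OF u_lim]
      by (rule LIMSEQ_le) (use u_le_T in blast)
  qed
  then have T_L: "optimal_backup L = L" by blast
  define p_star where "p_star s = softmax (\<lambda>a. L s a / \<alpha>)" for s
  show ?thesis
  proof (intro exI[of _ p_star] conjI allI)
    fix s a
    have "(\<lambda>k. pmf (softmax (\<lambda>a. u k s a / \<alpha>)) a) \<longlonglongrightarrow> pmf (p_star s) a"
      unfolding p_star_def by (intro tendsto_pmf_softmax tendsto_intros u_lim) (use \<alpha> in simp)
    \<comment> \<open>Policies are known to be softmaxes only from index one on; the shift discards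
      the arbitrary initial policy.\<close>
    then have "(\<lambda>k. pmf (p (Suc k) s) a) \<longlonglongrightarrow> pmf (p_star s) a"
      using \<alpha> by (simp add: step u_def)
    then show "(\<lambda>k. pmf (p k s) a) \<longlonglongrightarrow> pmf (p_star s) a" by (rule LIMSEQ_imp_Suc)
  next
    fix q s a
    have "scalar_Q q s a \<le> L s a"
      using policy_backup_le_optimal_backup[of q L] by (intro scalar_Q_le) (simp add: T_L)
    also have "\<dots> \<le> scalar_Q p_star s a"
      by (intro le_scalar_Q) (simp add: policy_backup_softmax p_star_def T_L)
    finally show "scalar_Q q s a \<le> scalar_Q p_star s a" .
  qed
qed

end

section \<open>From the algorithm to the scalarized iteration\<close>

text \<open>The target has full support and is itself a competitor with divergence zero, so the
  minimizer has divergence zero and must equal it.\<close>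

lemma pensieve_iteration_step:
  assumes "pensieve_iteration P r \<gamma> \<alpha> W \<Q> \<pi>" and "l \<in> unit_simplex"
  shows "\<pi> (Suc k) l s = pensieve_target \<alpha> (W k l) (\<Q> k) l s"
proof -
  let ?t = "pensieve_target \<alpha> (W k l) (\<Q> k) l"
  have pos: "0 < pmf (?t s) a" for a by (simp add: pensieve_target_eq_softmax pmf_softmax_pos)
  have "KL_pmf (\<pi> (Suc k) l s) (?t s) \<le> KL_pmf (?t s) (?t s)"
    using assms by (auto simp: pensieve_iteration_def is_arg_min_linorder)
  also have "\<dots> = 0" using KL_pmf_eq_0_iff[OF pos] by blast
  finally show ?thesis using KL_pmf_nonneg[OF pos] KL_pmf_eq_0_iff[OF pos] by (metis order_antisym)
qed

theorem theorem3p1: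
  fixes P :: "'s::finite \<Rightarrow> 'a::finite \<Rightarrow> 's pmf"
    and r :: "'s \<Rightarrow> 'a \<Rightarrow> real ^ 'd::finite"
    and r_max \<gamma> \<alpha> :: real
    and W :: "nat \<Rightarrow> real ^ 'd \<Rightarrow> (real ^ 'd) set"
    and \<Q> :: "nat \<Rightarrow> ('s, 'a, 'd) pref_Q set"
    and \<pi> :: "nat \<Rightarrow> ('s, 'a, 'd) pref_policy"
  assumes "\<And>s a i. \<bar>r s a $ i\<bar> \<le> r_max"
    and "0 < \<gamma>" and "\<gamma> < 1" and "0 < \<alpha>"
    and "pensieve_iteration P r \<gamma> \<alpha> W \<Q> \<pi>"
  shows "\<exists>\<pi>_star :: ('s, 'a, 'd) pref_policy.
           (\<forall>l\<in>unit_simplex. \<forall>s a. (\<lambda>k. pmf (\<pi> k l s) a) \<longlonglongrightarrow> pmf (\<pi>_star l s) a) \<and>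
           (\<forall>p :: ('s, 'a) policy. \<forall>s a. \<forall>l\<in>unit_simplex.
              l \<bullet> pref_soft_Q P r \<gamma> \<alpha> \<pi>_star l s a \<ge> l \<bullet> soft_Q P r \<gamma> \<alpha> p s a)"
proof -
  have "\<exists>p_star. (\<forall>s a. (\<lambda>k. pmf (\<pi> k l s) a) \<longlonglongrightarrow> pmf (p_star s) a) \<and>
      (\<forall>p s a. l \<bullet> soft_Q P r \<gamma> \<alpha> p s a \<le> l \<bullet> soft_Q P r \<gamma> \<alpha> p_star s a)"
    if l: "l \<in> unit_simplex" for l
  proof -
    interpret scalarized_soft_mdp P r \<gamma> \<alpha> l using assms(2-4) l by (rule scalarized_soft_mdp.intro)
    define snapshots where "snapshots k = (\<lambda>(l', Q'). Q' l') ` (W k l \<times> \<Q> k)" for k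
    \<comment> \<open>All policies whose soft Q-function occurs among the snapshot values. Several
      policies may share one Q-function, which does not affect the supremum.\<close>
    define S where "S k = soft_Q P r \<gamma> \<alpha> -` snapshots k" for k
    have mem: "\<pi> k l \<in> S k" for k
    proof -
      have "l \<in> W k l" and "pref_soft_Q P r \<gamma> \<alpha> (\<pi> k) \<in> \<Q> k"
        using assms(5) l by (simp_all add: pensieve_iteration_def)
      then have "pref_soft_Q P r \<gamma> \<alpha> (\<pi> k) l \<in> snapshots k"
        unfolding snapshots_def by (intro image_eqI[of _ _ "(l, pref_soft_Q P r \<gamma> \<alpha> (\<pi> k))"]) auto
      then show ?thesis by (simp add: S_def pref_soft_Q_def)
    qed
    \<comment> \<open>A snapshot of \<open>\<pi> j\<close> at \<open>l'\<close> is the soft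
      Q-function of the policy \<open>\<pi> j l'\<close>; hence passing to the preimage
      \<open>S k\<close> loses no snapshot value.\<close>
    have "snapshots k \<subseteq> range (soft_Q P r \<gamma> \<alpha>)" for k
    proof -
      have "\<Q> k \<subseteq> {pref_soft_Q P r \<gamma> \<alpha> (\<pi> j) |j. j \<le> k}"
        using assms(5) by (simp add: pensieve_iteration_def)
      then have "Q' l' \<in> range (soft_Q P r \<gamma> \<alpha>)" if "Q' \<in> \<Q> k" for Q' l'
        using that unfolding pref_soft_Q_def by blast
      then show ?thesis unfolding snapshots_def by auto
    qed
    then have soft_Q_S: "soft_Q P r \<gamma> \<alpha> ` S k = snapshots k" for k
      unfolding S_def image_vimage_eq by (simp add: Int_absorb2)
    have snapshot_values: "(\<lambda>(l', Q'). (1 / \<alpha>) * (l \<bullet> Q' l' s a)) ` (W k l \<times> \<Q> k) =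
        (\<lambda>p. scalar_Q p s a / \<alpha>) ` S k" for k s a
    proof -
      have "(\<lambda>p. scalar_Q p s a / \<alpha>) ` S k =
          (\<lambda>Q. (1 / \<alpha>) * (l \<bullet> Q s a)) ` soft_Q P r \<gamma> \<alpha> ` S k"
        by (simp add: image_image scalar_Q_def)
      then show ?thesis
        by (simp add: soft_Q_S snapshots_def image_image case_prod_beta)
    qed
    have step: "\<pi> (Suc k) l s = softmax (\<lambda>a. SUP p\<in>S k. scalar_Q p s a / \<alpha>)" for k s
      by (simp only: pensieve_iteration_step[OF assms(5) l] pensieve_target_eq_softmax snapshot_values)
    have "l \<bullet> r s a \<le> r_max" for s a
      by (rule inner_le_unit_simplex[OF l]) (rule abs_le_D1[OF assms(1)])
    note bdd = scalar_Q_bounded[OF this]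
    show ?thesis
      using optimistic_soft_policy_iteration_converges[of "\<lambda>k. \<pi> k l", OF mem bdd step]
      unfolding scalar_Q_def .
  qed
  then have "\<forall>l\<in>unit_simplex. \<exists>p_star.
      (\<forall>s a. (\<lambda>k. pmf (\<pi> k l s) a) \<longlonglongrightarrow> pmf (p_star s) a) \<and>
      (\<forall>p s a. l \<bullet> soft_Q P r \<gamma> \<alpha> p s a \<le> l \<bullet> soft_Q P r \<gamma> \<alpha> p_star s a)"
    by (rule ballI)
  \<comment> \<open>The limit policies of the separate preferences are glued together by
    choice.\<close>
  from bchoice[OF this] obtain \<pi>_star where "\<forall>l\<in>unit_simplex.
      (\<forall>s a. (\<lambda>k. pmf (\<pi> k l s) a) \<longlonglongrightarrow> pmf (\<pi>_star l s) a) \<and>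
      (\<forall>p s a. l \<bullet> soft_Q P r \<gamma> \<alpha> p s a \<le> l \<bullet> soft_Q P r \<gamma> \<alpha> (\<pi>_star l) s a)"
    by (rule exE)
  then show ?thesis by (intro exI[of _ \<pi>_star]) (simp add: pref_soft_Q_def)
qed

end
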